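(* Let $n\ge 3$, let $b>2$, and let $\widetilde b\in\mathbb{R}$ be such that $\widetilde T_n$ is invertible. Put $\beta=\widetilde b-b$. Then for all $1\le j\le i\le n$ the $(i,j)$ entry of $\widetilde T_n^{-1}$ is $$\widetilde t^{-1}_{i,j}=C\,(\gamma_{n+1-i}+\beta\gamma_{n-i})(\gamma_j+\beta\gamma_{j-1}),\qquad C=\frac{\gamma_{n+1}}{\gamma_1\left((\gamma_{n+1}+\beta\gamma_n)^2-(\beta\gamma_1)^2\right)}.$$
   Context: For an integer $n\ge 3$ and real $b,\widetilde b$, $\widetilde T_n$ is the $n\times n$ real symmetric tridiagonal matrix with diagonal entries $(\widetilde b,b,b,\dots,b,\widetilde b)$ (first and last equal to $\widetilde b$, all others equal to $b$) and all sub- and superdiagonal entries equal to $-1$. When it is invertible, $\widetilde t^{-1}_{i,j}$ denotes the $(i,j)$ entry of $\widetilde T_n^{-1}$. For $b>2$ put $r_1=\tfrac12(b+\sqrt{b^2-4})$, $r_2=\tfrac12(b-\sqrt{b^2-4})$ and $\gamma_k=r_1^k-r_2^k$ (so $\gamma_0=0$, $\gamma_1=\sqrt{b^2-4}$). *)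

theory Defs
  imports Complex_Main "Jordan_Normal_Form.Gauss_Jordan_Elimination"
begin

(* Matrix indices in Jordan_Normal_Form start at 0, so the two corner entries
   sit at positions 0 and n - 1. *)
definition T_tilde :: "nat \<Rightarrow> real \<Rightarrow> real \<Rightarrow> real mat" where
  "T_tilde n b bt = mat n n (\<lambda>(i, j).
     if i = j then (if i = 0 \<or> i = n - 1 then bt else b)
     else if i = Suc j \<or> j = Suc i then - 1
     else 0)"

(* The entries of the inverse are numbered from 1, as in t_{i,j} with 1 \<le> i, j \<le> n.
   The value is meaningful only if the matrix is invertible: otherwise
   mat_inverse returns None. *)
definition T_tilde_inv_entry :: "nat \<Rightarrow> real \<Rightarrow> real \<Rightarrow> nat \<Rightarrow> nat \<Rightarrow> real" where
  "T_tilde_inv_entry n b bt i j = the (mat_inverse (T_tilde n b bt)) $$ (i - 1, j - 1)"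

definition r1 :: "real \<Rightarrow> real" where
  "r1 b = (b + sqrt (b\<^sup>2 - 4)) / 2"

definition r2 :: "real \<Rightarrow> real" where
  "r2 b = (b - sqrt (b\<^sup>2 - 4)) / 2"

definition gam :: "real \<Rightarrow> nat \<Rightarrow> real" where
  "gam b k = r1 b ^ k - r2 b ^ k"

end

theory Submission
  imports Defs
begin

text \<open>
  Indices count from 0 here. The sequence \<open>u k = \<gamma>\<^sub>k\<^sub>+\<^sub>1 + \<beta> \<gamma>\<^sub>k\<close> solves the three-term
  recurrence of the matrix together with the boundary condition of the first row, and its reflection
  \<open>u (n - 1 - k)\<close> satisfies that of the last row. Hence \<open>u (min i j) * u (n - 1 - max i j)\<close> is a
  discrete Green's function: its product with the matrix is the scalar matrix given by the Casoratian
  \<open>W = \<gamma>\<^sub>1 (\<gamma>\<^sub>n\<^sub>+\<^sub>1 + 2 \<beta> \<gamma>\<^sub>n + \<beta>\<^sup>2 \<gamma>\<^sub>n\<^sub>-\<^sub>1)\<close>. If \<open>W = 0\<close>, invertibility would force this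
  Green's function to vanish, but its corner entry is \<open>\<gamma>\<^sub>1\<^sup>2\<close>. The identity
  \<open>\<gamma>\<^sub>n\<^sub>-\<^sub>1 \<gamma>\<^sub>n\<^sub>+\<^sub>1 = \<gamma>\<^sub>n\<^sup>2 - \<gamma>\<^sub>1\<^sup>2\<close> turns \<open>1 / W\<close> into \<open>C\<close>.
\<close>

lemma r1_mult_r2: "2 < b \<Longrightarrow> r1 b * r2 b = 1"
proof -
  assume "2 < b"
  hence "4 \<le> b\<^sup>2" using power_mono[of 2 b 2] by simp
  thus ?thesis by (simp add: r1_def r2_def field_simps power2_eq_square)
qed

lemma r1_plus_r2: "r1 b + r2 b = b"
  by (simp add: r1_def r2_def field_simps)

lemma gam_0 [simp]: "gam b 0 = 0"
  by (simp add: gam_def)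

lemma gam_pos:
  assumes "2 < b" "0 < k"
  shows "0 < gam b k"
proof -
  have "4 < b\<^sup>2" using power_strict_mono[of 2 b 2] assms by simp
  moreover have "sqrt (b\<^sup>2 - 4) < b" using assms by (intro real_less_lsqrt) auto
  ultimately have "0 \<le> r2 b" "r2 b < r1 b" by (auto simp: r1_def r2_def)
  thus ?thesis using assms power_strict_mono[of "r2 b" "r1 b" k] by (simp add: gam_def)
qed

lemma gam_rec:
  assumes "2 < b"
  shows "gam b (Suc (Suc k)) = b * gam b (Suc k) - gam b k"
proof -
  have "x ^ Suc (Suc k) - y ^ Suc (Suc k) =
      (x + y) * (x ^ Suc k - y ^ Suc k) - x * y * (x ^ k - y ^ k)" for x y :: real
    by (simp add: algebra_simps)
  from this[of "r1 b" "r2 b"] show ?thesis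
    using assms by (simp add: gam_def r1_mult_r2 r1_plus_r2)
qed

text \<open>In powers of \<open>r1 b\<close> and \<open>r2 b\<close> the mixed terms cancel because
  \<open>r1 b * r2 b = 1\<close>. The difference thus depends only on the sum of the
  indices.\<close>

lemma gam_casoratian:
  assumes "2 < b"
  shows "gam b (Suc k) * gam b (Suc m) - gam b k * gam b m = gam b (Suc 0) * gam b (Suc (k + m))"
proof -
  have "(x * x ^ k - y * y ^ k) * (x * x ^ m - y * y ^ m)
        - x * y * ((x ^ k - y ^ k) * (x ^ m - y ^ m))
      = (x - y) * (x * (x ^ k * x ^ m) - y * (y ^ k * y ^ m))" for x y :: real
    by (simp add: algebra_simps)
  from this[of "r1 b" "r2 b"] show ?thesis
    using assms by (simp add: gam_def r1_mult_r2 power_add)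
qed

text \<open>The index pairs \<open>(k + 2, k)\<close> and \<open>(k + 1, k + 1)\<close> have equal
  sums. Comparing their Casoratians shows that the difference of the product and the middle square
  is constant in \<open>k\<close>; \<open>k = 0\<close> gives its value.\<close>

lemma gam_neighbour_product:
  assumes "2 < b"
  shows "gam b (Suc (Suc k)) * gam b k = (gam b (Suc k))\<^sup>2 - (gam b (Suc 0))\<^sup>2"
proof (induction k)
  case (Suc k)
  show ?case
    using gam_casoratian[OF assms, of "Suc (Suc k)" k]
      gam_casoratian[OF assms, of "Suc k" "Suc k"] Suc
    by (simp add: power2_eq_square)
qed simp

definition edge_seq :: "real \<Rightarrow> real \<Rightarrow> nat \<Rightarrow> real" where
  "edge_seq b \<beta> k = gam b (Suc k) + \<beta> * gam b k"

text \<open>For \<open>b > 2\<close>, the value at \<open>n - 1\<close> is the determinant of the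
  matrix times the square of \<open>gam b 1\<close>.\<close>

definition edge_casoratian :: "real \<Rightarrow> real \<Rightarrow> nat \<Rightarrow> real" where
  "edge_casoratian b \<beta> k =
     gam b 1 * (gam b (k + 2) + 2 * \<beta> * gam b (k + 1) + \<beta>\<^sup>2 * gam b k)"

definition green_mat :: "nat \<Rightarrow> real \<Rightarrow> real \<Rightarrow> real mat" where
  "green_mat n b \<beta> =
     mat n n (\<lambda>(i, j). edge_seq b \<beta> (min i j) * edge_seq b \<beta> (n - 1 - max i j))"

lemma edge_seq_0: "edge_seq b \<beta> 0 = gam b 1"
  by (simp add: edge_seq_def)

text \<open>This is the boundary condition of the first row, and by reflection that of the
  last.\<close>

lemma edge_seq_1: "2 < b \<Longrightarrow> edge_seq b \<beta> 1 = (b + \<beta>) * edge_seq b \<beta> 0"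
  by (simp add: edge_seq_def gam_rec algebra_simps)

lemma edge_seq_rec:
  "2 < b \<Longrightarrow> edge_seq b \<beta> (Suc (Suc k)) = b * edge_seq b \<beta> (Suc k) - edge_seq b \<beta> k"
  by (simp add: edge_seq_def gam_rec algebra_simps)

text \<open>Expanding in powers of \<beta> leaves four Casoratians of \<open>gam\<close>; the two
  linear ones have equal index sums, hence the factor 2.\<close>

lemma edge_seq_casoratian:
  assumes "2 < b"
  shows "edge_seq b \<beta> (Suc k) * edge_seq b \<beta> (Suc m) - edge_seq b \<beta> k * edge_seq b \<beta> m =
    edge_casoratian b \<beta> (Suc (k + m))"
proof -
  let ?g = "gam b"
  have "edge_seq b \<beta> (Suc k) * edge_seq b \<beta> (Suc m) - edge_seq b \<beta> k * edge_seq b \<beta> m =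
      (?g (Suc (Suc k)) * ?g (Suc (Suc m)) - ?g (Suc k) * ?g (Suc m))
      + \<beta> * (?g (Suc k) * ?g (Suc (Suc m)) - ?g k * ?g (Suc m))
      + \<beta> * (?g (Suc (Suc k)) * ?g (Suc m) - ?g (Suc k) * ?g m)
      + \<beta>\<^sup>2 * (?g (Suc k) * ?g (Suc m) - ?g k * ?g m)"
    by (simp add: edge_seq_def power2_eq_square algebra_simps)
  also have "\<dots> = edge_casoratian b \<beta> (Suc (k + m))"
    unfolding gam_casoratian[OF assms] by (simp add: edge_casoratian_def algebra_simps)
  finally show ?thesis .
qed

text \<open>The recurrence turns the left side into \<open>edge_seq b \<beta> (k + 2) + \<beta> *
  edge_seq b \<beta> (k + 1)\<close>. It evaluates the two corner entries of the product.\<close>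

lemma edge_seq_last:
  assumes "2 < b"
  shows "(b + \<beta>) * edge_seq b \<beta> (Suc k) - edge_seq b \<beta> k =
    gam b (k + 3) + 2 * \<beta> * gam b (k + 2) + \<beta>\<^sup>2 * gam b (k + 1)"
  using assms by (simp add: edge_seq_def gam_rec numeral_3_eq_3 power2_eq_square algebra_simps)

lemma sum_tridiagonal_row:
  fixes f :: "nat \<Rightarrow> real"
  assumes "i < n"
  shows "(\<Sum>k<n. T_tilde n b bt $$ (i, k) * f k) =
    (if i = 0 \<or> i = n - 1 then bt else b) * f i
    - (if i = 0 then 0 else f (i - 1)) - (if Suc i < n then f (Suc i) else 0)"
proof -
  let ?d = "if i = 0 \<or> i = n - 1 then bt else b"
  \<comment> \<open>Selecting by \<open>Suc k = i\<close> avoids truncated subtraction: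
    \<open>k = i - 1\<close> would pick a spurious term in row 0.\<close>
  have "T_tilde n b bt $$ (i, k) * f k = (if k = i then ?d * f k else 0)
      - (if Suc k = i then f k else 0) - (if k = Suc i then f k else 0)" if "k < n" for k
  proof (cases "k = i")
    case False
    thus ?thesis using assms that by (simp add: T_tilde_def eq_commute[of i])
  qed (use that in \<open>simp add: T_tilde_def\<close>)
  hence "(\<Sum>k<n. T_tilde n b bt $$ (i, k) * f k) = (\<Sum>k<n. (if k = i then ?d * f k else 0)
      - (if Suc k = i then f k else 0) - (if k = Suc i then f k else 0))"
    by (intro sum.cong) simp_all
  also have "\<dots> = ?d * f i - (\<Sum>k<n. if Suc k = i then f k else 0)
      - (if Suc i < n then f (Suc i) else 0)"
    using assms by (simp add: sum_subtractf)
  also have "(\<Sum>k<n. if Suc k = i then f k else 0) = (if i = 0 then 0 else f (i - 1))"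
    using assms by (cases i) simp_all
  finally show ?thesis .
qed

lemma T_tilde_mult_green_mat:
  assumes "3 \<le> n" "2 < b"
  shows "T_tilde n b (b + \<beta>) * green_mat n b \<beta> = edge_casoratian b \<beta> (n - 1) \<cdot>\<^sub>m 1\<^sub>m n"
proof (rule eq_matI)
  fix i j
  assume "i < dim_row (edge_casoratian b \<beta> (n - 1) \<cdot>\<^sub>m 1\<^sub>m n)"
    and "j < dim_col (edge_casoratian b \<beta> (n - 1) \<cdot>\<^sub>m 1\<^sub>m n)"
  hence ij: "i < n" "j < n" by auto
  define u where "u = edge_seq b \<beta>"
  define f where "f k = u (min k j) * u (n - 1 - max k j)" for k
  note u1 = edge_seq_1[OF assms(2), of \<beta>, folded u_def]
  note urec = edge_seq_rec[OF assms(2), of \<beta>, folded u_def]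
  have "(T_tilde n b (b + \<beta>) * green_mat n b \<beta>) $$ (i, j) =
      (\<Sum>k<n. T_tilde n b (b + \<beta>) $$ (i, k) * f k)"
    using ij by (auto simp: T_tilde_def green_mat_def scalar_prod_def f_def u_def
        lessThan_atLeast0 intro!: sum.cong)
  also have "\<dots> = (if i = 0 \<or> i = n - 1 then b + \<beta> else b) * f i
      - (if i = 0 then 0 else f (i - 1)) - (if Suc i < n then f (Suc i) else 0)"
    by (rule sum_tridiagonal_row[OF ij(1)])
  also have "\<dots> = (if i = j then edge_casoratian b \<beta> (n - 1) else 0)"
  proof (cases i j rule: linorder_cases)
    case less
    show ?thesis
    proof (cases i)
      case 0
      thus ?thesis using less ij assms u1 by (simp add: f_def)
    next
      case (Suc k)
      thus ?thesis using less ij by (auto simp: f_def urec algebra_simps)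
    qed
  next
    \<comment> \<open>Below the diagonal the column is a multiple of the reflected sequence, so its
      last row uses \<open>u1\<close>.\<close>
    case greater
    have fk: "f k = u j * u (n - 1 - k)" if "j \<le> k" for k
      using that by (simp only: f_def min_absorb2 max_absorb1)
    from greater obtain p where p: "i = Suc p" "j \<le> p" by (cases i) simp_all
    show ?thesis
    proof (cases "Suc i = n")
      case True
      hence "f i = u j * u 0" "f p = u j * u 1"
        using p fk[of i] fk[of p] by (simp_all flip: True)
      thus ?thesis using p u1 by (simp flip: True)
    next
      case False
      then obtain k where n: "n = Suc (Suc i) + k"
        using ij(1) by (metis Suc_leI le_Suc_ex less_le)
      have "f i = u j * u (Suc k)" "f p = u j * u (Suc (Suc k))" "f (Suc i) = u j * u k"
        using p fk[of i] fk[of p] fk[of "Suc i"] by (simp_all add: n)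
      hence "b * f i - f p - f (Suc i) = 0"
        by (simp only: urec) (simp add: algebra_simps)
      thus ?thesis using p by (simp add: n)
    qed
  next
    case equal
    obtain m where n: "n = m + 3" using assms by (metis add.commute le_Suc_ex)
    note last = edge_seq_last[OF assms(2), of \<beta>, folded u_def]
    \<comment> \<open>Both corners \<open>(0, 0)\<close> and \<open>(n - 1, n - 1)\<close> of the
      product give this same expression.\<close>
    have W: "edge_casoratian b \<beta> (n - 1) = u 0 * ((b + \<beta>) * u (Suc (Suc m)) - u (Suc m))"
      using last[of "Suc m"]
      by (simp add: n u_def edge_seq_0 edge_casoratian_def eval_nat_numeral)
    show ?thesis
    proof (cases "i = 0 \<or> i = n - 1")
      case True
      thus ?thesis unfolding W using equal ij
        by (auto simp: f_def n algebra_simps eval_nat_numeral)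
    next
      case False
      then obtain k where k: "i = Suc k" by (cases i) auto
      \<comment> \<open>Chosen so that \<open>n - 1 - i = Suc l\<close>; then
        \<open>b * u (Suc k) - u k = u (Suc (Suc k))\<close> turns the row sum into a
        Casoratian.\<close>
      define l where "l = n - 3 - k"
      have l: "n = Suc (Suc (k + Suc l))"
        using False k ij by (simp add: l_def)
      have "u (Suc (Suc k)) * u (Suc l) - u (Suc k) * u l = edge_casoratian b \<beta> (n - 1)"
        using edge_seq_casoratian[OF assms(2), of \<beta> "Suc k" l] by (simp add: u_def l)
      moreover have "f i = u (Suc k) * u (Suc l)" "f (i - 1) = u k * u (Suc l)"
        "f (Suc i) = u (Suc k) * u l"
        using equal k l by (auto simp: f_def)
      ultimately show ?thesis using False equal k l urec[of k] by (simp add: algebra_simps)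
    qed
  qed
  finally show "(T_tilde n b (b + \<beta>) * green_mat n b \<beta>) $$ (i, j) =
      (edge_casoratian b \<beta> (n - 1) \<cdot>\<^sub>m 1\<^sub>m n) $$ (i, j)"
    using ij by simp
qed (simp_all add: T_tilde_def green_mat_def)

lemma invertible_mat_imp_mat_inverse:
  fixes A :: "'a :: field mat"
  assumes "A \<in> carrier_mat n n" "invertible_mat A"
  obtains B where "mat_inverse A = Some B" "B \<in> carrier_mat n n" "B * A = 1\<^sub>m n"
proof -
  obtain B where AB: "A * B = 1\<^sub>m n" "B * A = 1\<^sub>m (dim_row B)"
    using assms by (auto simp: invertible_mat_def inverts_mat_def)
  \<comment> \<open>\<open>invertible_mat\<close> does not fix the size of its witness; the
    dimensions are read off from the two products.\<close>
  have "B \<in> carrier_mat n n"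
    using assms(1) AB by (metis carrier_matD(2) carrier_matI index_mult_mat(2,3) index_one_mat(2,3))
  hence "A \<in> Units (ring_mat TYPE('a) n ())"
    using assms(1) AB by (auto simp: Units_def ring_mat_def)
  then obtain C where "mat_inverse A = Some C"
    using mat_inverse(1)[OF assms(1), where b = "()"] by (cases "mat_inverse A") auto
  thus thesis using that mat_inverse(2)[OF assms(1)] by blast
qed

theorem lemma3p2:
  fixes n :: nat and b bt :: real
  assumes "n \<ge> 3"
    and "b > 2"
    and "invertible_mat (T_tilde n b bt)"
  shows "let \<beta> = bt - b;
             C = gam b (n + 1) /
                 (gam b 1 * ((gam b (n + 1) + \<beta> * gam b n)\<^sup>2 - (\<beta> * gam b 1)\<^sup>2))
         in \<forall>i j. 1 \<le> j \<and> j \<le> i \<and> i \<le> n \<longrightarrow>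
              T_tilde_inv_entry n b bt i j =
                C * (gam b (n + 1 - i) + \<beta> * gam b (n - i)) * (gam b j + \<beta> * gam b (j - 1))"
proof -
  define \<beta> where "\<beta> = bt - b"
  define W where "W = edge_casoratian b \<beta> (n - 1)"
  define C where "C = gam b (n + 1) /
    (gam b 1 * ((gam b (n + 1) + \<beta> * gam b n)\<^sup>2 - (\<beta> * gam b 1)\<^sup>2))"
  let ?T = "T_tilde n b bt" and ?G = "green_mat n b \<beta>"
  have T: "?T \<in> carrier_mat n n" and G: "?G \<in> carrier_mat n n"
    by (simp_all add: T_tilde_def green_mat_def)
  obtain B where B: "mat_inverse ?T = Some B" "B \<in> carrier_mat n n" "B * ?T = 1\<^sub>m n"
    using invertible_mat_imp_mat_inverse[OF T assms(3)] by blast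
  have TG: "?T * ?G = W \<cdot>\<^sub>m 1\<^sub>m n"
    using T_tilde_mult_green_mat[OF assms(1,2), of \<beta>] by (simp add: \<beta>_def W_def)
  \<comment> \<open>Multiplying by \<open>B\<close> instead of dividing by \<open>W\<close> keeps
    the identity available before \<open>W\<close> is known to be nonzero.\<close>
  have "?G = (B * ?T) * ?G" using B G by simp
  also have "\<dots> = B * (W \<cdot>\<^sub>m 1\<^sub>m n)" using assoc_mult_mat[OF B(2) T G] TG by simp
  also have "\<dots> = W \<cdot>\<^sub>m B" using B by (simp add: mult_smult_distrib[of _ n n _ n])
  finally have entry: "?G $$ (i, j) = W * B $$ (i, j)" if "i < n" "j < n" for i j
    using B that by simp
  have "W \<noteq> 0"
  proof
    assume "W = 0"
    hence "?G $$ (n - 1, 0) = 0" using entry[of "n - 1" 0] assms by simp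
    thus False using assms gam_pos[of b "Suc 0"] by (simp add: green_mat_def edge_seq_0)
  qed
  have product: "gam b (n - 1) * gam b (n + 1) = (gam b n)\<^sup>2 - (gam b 1)\<^sup>2"
    using gam_neighbour_product[OF assms(2), of "n - 1"] assms(1) by (simp add: mult.commute)
  \<comment> \<open>With \<open>product\<close>, every term acquires the factor
    \<open>gam b (n + 1)\<close>, which cancels the numerator of \<open>C\<close>.\<close>
  have "(gam b (n + 1) + \<beta> * gam b n)\<^sup>2 - (\<beta> * gam b 1)\<^sup>2 =
      gam b (n + 1) * (gam b (n + 1) + 2 * \<beta> * gam b n)
      + \<beta>\<^sup>2 * (gam b (n - 1) * gam b (n + 1))"
    unfolding product by (simp add: power2_eq_square algebra_simps)
  also have "\<dots> =
      gam b (n + 1) * (gam b (n + 1) + 2 * \<beta> * gam b n + \<beta>\<^sup>2 * gam b (n - 1))"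
    by (simp add: algebra_simps)
  finally have "gam b 1 * ((gam b (n + 1) + \<beta> * gam b n)\<^sup>2 - (\<beta> * gam b 1)\<^sup>2) =
      gam b (n + 1) * W"
    using assms(1) by (simp add: W_def edge_casoratian_def)
  hence C: "C = 1 / W"
    using gam_pos[OF assms(2), of "n + 1"] by (simp add: C_def)
  have "T_tilde_inv_entry n b bt i j =
      C * (gam b (n + 1 - i) + \<beta> * gam b (n - i)) * (gam b j + \<beta> * gam b (j - 1))"
    if ij: "1 \<le> j" "j \<le> i" "i \<le> n" for i j
  proof -
    have "W * B $$ (i - 1, j - 1) = edge_seq b \<beta> (j - 1) * edge_seq b \<beta> (n - i)"
    proof -
      have "i - 1 < n" "j - 1 < n" "min (i - 1) (j - 1) = j - 1" "max (i - 1) (j - 1) = i - 1"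
        "n - 1 - (i - 1) = n - i"
        using ij by auto
      thus ?thesis
        using entry[of "i - 1" "j - 1"] unfolding green_mat_def by (simp only: index_mat split)
    qed
    moreover have "T_tilde_inv_entry n b bt i j = B $$ (i - 1, j - 1)"
      by (simp add: T_tilde_inv_entry_def B)
    ultimately have "T_tilde_inv_entry n b bt i j =
        C * edge_seq b \<beta> (n - i) * edge_seq b \<beta> (j - 1)"
      using \<open>W \<noteq> 0\<close> by (simp add: C field_simps)
    thus ?thesis using ij by (simp add: edge_seq_def Suc_diff_le)
  qed
  thus ?thesis by (simp add: Let_def \<beta>_def C_def)
qed

end
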